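(* Let $n\ge 2$, let $a_1,\dots,a_n\in\mathbb{C}$, let $R=\mathbb{Z}[a_1,\dots,a_n]\subseteq\mathbb{C}$, let $p(x)=x^n-a_1x^{n-1}-\cdots-a_{n-1}x-a_n$, and consider the universal $sl(n)$ Frobenius extension $R\hookrightarrow A=R[x]/(p(x))$ with its genus-reduction term $g\in A$. Assume that $p(x)$ has at least one (complex) root of multiplicity precisely $1$. Then $g^2\neq 0$ in $A$.
   Context: The universal $sl(n)$ Frobenius extension is $R\hookrightarrow A=R[x]/(p(x))$ together with the $R$-linear Frobenius form $\varepsilon:A\to R$ given on the basis $\{1,x,\dots,x^{n-1}\}$ by $\varepsilon(x^k)=0$ for $0\le k\le n-2$ and $\varepsilon(x^{n-1})=1$. A dual basis for it is the collection of pairs $(x_k,y_k)=(x^{n-1-k},\,x^k-a_1x^{k-1}-\cdots-a_k)$, $0\le k\le n-1$, which satisfy $a=\sum_k x_k\varepsilon(y_ka)=\sum_k\varepsilon(ax_k)y_k$ for all $a\in A$. The genus-reduction term is $g=\sum_k x_ky_k\in A$; explicitly $g=nx^{n-1}-(n-1)a_1x^{n-2}-(n-2)a_2x^{n-3}-\cdots-a_{n-1}$. The case of indeterminate $a_i$, or of $a_i$ subject to relations, is covered by choosing suitable complex numbers $a_i$. *)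

theory Defs
  imports "HOL-Algebra.Generated_Rings" "HOL-Algebra.Algebraic_Closure_Type" Complex_Main
begin

definition sl_base :: "(nat \<Rightarrow> complex) \<Rightarrow> nat \<Rightarrow> complex set" where
  "sl_base a n = generate_ring ring_of_type_algebra (a ` {1..n})"

definition sl_poly_ring :: "(nat \<Rightarrow> complex) \<Rightarrow> nat \<Rightarrow> complex poly ring" where
  "sl_poly_ring a n =
     ring_of_type_algebra\<lparr>carrier := {f. \<forall>i. Polynomial.coeff f i \<in> sl_base a n}\<rparr>"

text \<open>The polynomial \<open>x^k - a\<^sub>1 x^(k-1) - \<dots> - a\<^sub>k\<close>. For \<open>k = n\<close> this is \<open>p(x)\<close>; for
  \<open>k < n\<close> it represents the second component \<open>y\<^sub>k\<close> of the dual basis.\<close>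

definition sl_poly :: "(nat \<Rightarrow> complex) \<Rightarrow> nat \<Rightarrow> complex poly" where
  "sl_poly a k = Polynomial.monom 1 k - (\<Sum>i=1..k. Polynomial.monom (a i) (k - i))"

definition sl_ext :: "(nat \<Rightarrow> complex) \<Rightarrow> nat \<Rightarrow> complex poly set ring" where
  "sl_ext a n = sl_poly_ring a n Quot (PIdl\<^bsub>sl_poly_ring a n\<^esub> (sl_poly a n))"

definition sl_class :: "(nat \<Rightarrow> complex) \<Rightarrow> nat \<Rightarrow> complex poly \<Rightarrow> complex poly set" where
  "sl_class a n f = (PIdl\<^bsub>sl_poly_ring a n\<^esub> (sl_poly a n)) +>\<^bsub>sl_poly_ring a n\<^esub> f"

definition sl_embed :: "(nat \<Rightarrow> complex) \<Rightarrow> nat \<Rightarrow> complex \<Rightarrow> complex poly set" where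
  "sl_embed a n c = sl_class a n [:c:]"

text \<open>The coordinate at \<open>x^(n-1)\<close> with respect to the basis \<open>1, x, \<dots>, x^(n-1)\<close>: every class
  contains exactly one polynomial of degree less than \<open>n\<close>.\<close>

definition sl_form :: "(nat \<Rightarrow> complex) \<Rightarrow> nat \<Rightarrow> complex poly set \<Rightarrow> complex" where
  "sl_form a n u = (THE c. \<exists>f\<in>u. Polynomial.degree f < n \<and> c = Polynomial.coeff f (n - 1))"

definition sl_dual_x :: "(nat \<Rightarrow> complex) \<Rightarrow> nat \<Rightarrow> nat \<Rightarrow> complex poly set" where
  "sl_dual_x a n k = sl_class a n (Polynomial.monom 1 (n - 1 - k))"

definition sl_dual_y :: "(nat \<Rightarrow> complex) \<Rightarrow> nat \<Rightarrow> nat \<Rightarrow> complex poly set" where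
  "sl_dual_y a n k = sl_class a n (sl_poly a k)"

definition sl_genus :: "(nat \<Rightarrow> complex) \<Rightarrow> nat \<Rightarrow> complex poly set" where
  "sl_genus a n =
     (\<Oplus>\<^bsub>sl_ext a n\<^esub>k\<in>{0..n - 1}. sl_dual_x a n k \<otimes>\<^bsub>sl_ext a n\<^esub> sl_dual_y a n k)"

lemma sl_base_zero: "0 \<in> sl_base a n"
  and sl_base_one: "1 \<in> sl_base a n"
  and sl_base_gen: "i \<in> {1..n} \<Longrightarrow> a i \<in> sl_base a n"
  and sl_base_add: "r \<in> sl_base a n \<Longrightarrow> s \<in> sl_base a n \<Longrightarrow> r + s \<in> sl_base a n"
  and sl_base_mult: "r \<in> sl_base a n \<Longrightarrow> s \<in> sl_base a n \<Longrightarrow> r * s \<in> sl_base a n"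
  and sl_base_uminus: "r \<in> sl_base a n \<Longrightarrow> - r \<in> sl_base a n"
proof -
  interpret C: ring "ring_of_type_algebra :: complex ring" by (rule ring_from_type_algebra)
  have inv: "\<ominus>\<^bsub>ring_of_type_algebra\<^esub> r = - r" for r :: complex
    by (rule C.minus_equality) (auto simp: ring_of_type_algebra_def)
  show "0 \<in> sl_base a n"
    using C.zero_in_generate[of "a ` {1..n}"]
    by (simp add: sl_base_def ring_of_type_algebra_def)
  show "1 \<in> sl_base a n"
    using generate_ring.one[of "ring_of_type_algebra :: complex ring" "a ` {1..n}"]
    by (simp add: sl_base_def ring_of_type_algebra_def)
  show "i \<in> {1..n} \<Longrightarrow> a i \<in> sl_base a n"
    unfolding sl_base_def by (rule generate_ring.incl) auto
  show "r \<in> sl_base a n \<Longrightarrow> s \<in> sl_base a n \<Longrightarrow> r + s \<in> sl_base a n"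
    using generate_ring.eng_add[of r "ring_of_type_algebra :: complex ring" "a ` {1..n}" s]
    by (simp add: sl_base_def ring_of_type_algebra_def)
  show "r \<in> sl_base a n \<Longrightarrow> s \<in> sl_base a n \<Longrightarrow> r * s \<in> sl_base a n"
    using generate_ring.eng_mult[of r "ring_of_type_algebra :: complex ring" "a ` {1..n}" s]
    by (simp add: sl_base_def ring_of_type_algebra_def)
  show "r \<in> sl_base a n \<Longrightarrow> - r \<in> sl_base a n"
    using generate_ring.a_inv[of r "ring_of_type_algebra :: complex ring" "a ` {1..n}"]
    by (simp add: sl_base_def inv)
qed

lemma sl_base_diff: "r \<in> sl_base a n \<Longrightarrow> s \<in> sl_base a n \<Longrightarrow> r - s \<in> sl_base a n"
  using sl_base_add[OF _ sl_base_uminus, of r a n s] by simp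

lemma sl_base_sum: "(\<And>i. i \<in> I \<Longrightarrow> f i \<in> sl_base a n) \<Longrightarrow> sum f I \<in> sl_base a n"
  by (induction I rule: infinite_finite_induct) (auto simp: sl_base_zero sl_base_add)

lemma sl_poly_ring_simps [simp]:
  "f \<oplus>\<^bsub>sl_poly_ring a n\<^esub> h = f + h"
  "f \<otimes>\<^bsub>sl_poly_ring a n\<^esub> h = f * h"
  "\<one>\<^bsub>sl_poly_ring a n\<^esub> = 1"
  "\<zero>\<^bsub>sl_poly_ring a n\<^esub> = 0"
  by (simp_all add: sl_poly_ring_def ring_of_type_algebra_def)

lemma sl_poly_ring_carrier:
  "f \<in> carrier (sl_poly_ring a n) \<longleftrightarrow> (\<forall>i. Polynomial.coeff f i \<in> sl_base a n)"
  by (simp add: sl_poly_ring_def)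

lemma sl_poly_ring_closed:
  "f \<in> carrier (sl_poly_ring a n) \<Longrightarrow> h \<in> carrier (sl_poly_ring a n) \<Longrightarrow>
     f + h \<in> carrier (sl_poly_ring a n)"
  "f \<in> carrier (sl_poly_ring a n) \<Longrightarrow> h \<in> carrier (sl_poly_ring a n) \<Longrightarrow>
     f * h \<in> carrier (sl_poly_ring a n)"
  "f \<in> carrier (sl_poly_ring a n) \<Longrightarrow> - f \<in> carrier (sl_poly_ring a n)"
  "f \<in> carrier (sl_poly_ring a n) \<Longrightarrow> h \<in> carrier (sl_poly_ring a n) \<Longrightarrow>
     f - h \<in> carrier (sl_poly_ring a n)"
  "c \<in> sl_base a n \<Longrightarrow> Polynomial.monom c k \<in> carrier (sl_poly_ring a n)"
  "c \<in> sl_base a n \<Longrightarrow> [:c:] \<in> carrier (sl_poly_ring a n)"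
  "c \<in> sl_base a n \<Longrightarrow> f \<in> carrier (sl_poly_ring a n) \<Longrightarrow>
     Polynomial.smult c f \<in> carrier (sl_poly_ring a n)"
  "1 \<in> carrier (sl_poly_ring a n)"
  unfolding sl_poly_ring_carrier
  by (simp_all add: coeff_mult coeff_1 sl_base_zero sl_base_one sl_base_add sl_base_mult
      sl_base_uminus sl_base_diff sl_base_sum coeff_pCons split: nat.split)

lemma sl_poly_ring_sum:
  "(\<And>i. i \<in> I \<Longrightarrow> f i \<in> carrier (sl_poly_ring a n)) \<Longrightarrow> sum f I \<in> carrier (sl_poly_ring a n)"
  by (auto simp: sl_poly_ring_carrier coeff_sum intro!: sl_base_sum)

lemma sl_poly_closed: "k \<le> n \<Longrightarrow> sl_poly a k \<in> carrier (sl_poly_ring a n)"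
  unfolding sl_poly_def
  by (intro sl_poly_ring_closed sl_poly_ring_sum sl_base_one sl_base_gen) auto

lemma cring_sl_poly_ring: "cring (sl_poly_ring a n)"
proof (rule cringI)
  show "abelian_group (sl_poly_ring a n)"
  proof (rule abelian_groupI)
    fix f assume "f \<in> carrier (sl_poly_ring a n)"
    thus "\<exists>h\<in>carrier (sl_poly_ring a n). h \<oplus>\<^bsub>sl_poly_ring a n\<^esub> f = \<zero>\<^bsub>sl_poly_ring a n\<^esub>"
      by (intro bexI[of _ "- f"]) (auto intro: sl_poly_ring_closed)
  qed (auto simp: sl_poly_ring_closed sl_poly_ring_carrier sl_base_zero sl_base_add)
  show "Group.comm_monoid (sl_poly_ring a n)"
    by (rule Group.comm_monoidI)
      (auto simp: sl_poly_ring_closed)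
qed (auto simp: algebra_simps)

lemma ideal_sl: "ideal (PIdl\<^bsub>sl_poly_ring a n\<^esub> (sl_poly a n)) (sl_poly_ring a n)"
  by (rule cring.cgenideal_ideal[OF cring_sl_poly_ring sl_poly_closed]) simp

lemma cring_sl_ext: "cring (sl_ext a n)"
  unfolding sl_ext_def by (rule ideal.quotient_is_cring[OF ideal_sl cring_sl_poly_ring])

lemma sl_class_hom: "ring_hom_cring (sl_poly_ring a n) (sl_ext a n) (sl_class a n)"
  unfolding sl_ext_def sl_class_def[abs_def]
  by (rule ideal.rcos_ring_hom_cring[OF ideal_sl cring_sl_poly_ring])

lemma sl_ext_carrierE:
  assumes "u \<in> carrier (sl_ext a n)"
  obtains f where "f \<in> carrier (sl_poly_ring a n)" "u = sl_class a n f"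
  using assms unfolding sl_ext_def FactRing_def A_RCOSETS_def' sl_class_def by auto

lemma sl_class_mem:
  "h \<in> sl_class a n f \<longleftrightarrow> (\<exists>q\<in>carrier (sl_poly_ring a n). h = q * sl_poly a n + f)"
  by (auto simp: sl_class_def cgenideal_def a_r_coset_def')

lemma sl_class_eqI:
  assumes "f \<in> carrier (sl_poly_ring a n)" "h \<in> carrier (sl_poly_ring a n)"
    "q \<in> carrier (sl_poly_ring a n)" "f = q * sl_poly a n + h"
  shows "sl_class a n f = sl_class a n h"
proof (intro Set.set_eqI iffI)
  fix u assume "u \<in> sl_class a n f"
  then obtain q' where "q' \<in> carrier (sl_poly_ring a n)" "u = q' * sl_poly a n + f"
    by (auto simp: sl_class_mem)
  thus "u \<in> sl_class a n h" using assms
    by (auto simp: sl_class_mem algebra_simps intro!: bexI[of _ "q' + q"] sl_poly_ring_closed)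
next
  fix u assume "u \<in> sl_class a n h"
  then obtain q' where "q' \<in> carrier (sl_poly_ring a n)" "u = q' * sl_poly a n + h"
    by (auto simp: sl_class_mem)
  thus "u \<in> sl_class a n f" using assms
    by (auto simp: sl_class_mem algebra_simps intro!: bexI[of _ "q' - q"] sl_poly_ring_closed)
qed

lemma coeff_sl_poly:
  "Polynomial.coeff (sl_poly a k) j = (if j = k then 1 else if j < k then - a (k - j) else 0)"
proof -
  have "(\<Sum>i=1..k. Polynomial.coeff (Polynomial.monom (a i) (k - i)) j) =
        (\<Sum>i=1..k. if i = k - j \<and> j < k then a i else 0)"
    by (intro sum.cong) auto
  also have "\<dots> = (if j < k then a (k - j) else 0)"
    by (cases "j < k") auto
  finally show ?thesis by (auto simp: sl_poly_def coeff_sum)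
qed

lemma degree_sl_poly [simp]: "Polynomial.degree (sl_poly a k) = k"
  by (intro antisym degree_le le_degree) (auto simp: coeff_sl_poly)

lemma sl_poly_nz [simp]: "sl_poly a k \<noteq> 0"
  using coeff_sl_poly[of a k k] by auto

lemma sl_poly_division:
  assumes "n \<ge> 1" "f \<in> carrier (sl_poly_ring a n)"
  shows "\<exists>q\<in>carrier (sl_poly_ring a n). \<exists>r\<in>carrier (sl_poly_ring a n).
           f = q * sl_poly a n + r \<and> Polynomial.degree r < n"
  using assms(2)
proof (induction "Polynomial.degree f" arbitrary: f rule: less_induct)
  case (less f)
  show ?case
  proof (cases "Polynomial.degree f < n")
    case True
    thus ?thesis using less.prems
      by (intro bexI[of _ 0] bexI[of _ f]) (auto simp: sl_poly_ring_carrier sl_base_zero)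
  next
    case False
    define m where "m = Polynomial.monom (lead_coeff f) (Polynomial.degree f - n)"
    define h where "h = f - m * sl_poly a n"
    have f0: "Polynomial.degree f > 0" "f \<noteq> 0" using False assms(1) by auto
    have m: "m \<in> carrier (sl_poly_ring a n)"
      using less.prems unfolding m_def
      by (intro sl_poly_ring_closed) (auto simp: sl_poly_ring_carrier)
    have h: "h \<in> carrier (sl_poly_ring a n)"
      unfolding h_def using m less.prems by (intro sl_poly_ring_closed sl_poly_closed) auto
    have dm: "Polynomial.degree (m * sl_poly a n) = Polynomial.degree f"
      using False f0 by (subst degree_mult_eq) (auto simp: m_def degree_monom_eq monom_eq_0_iff)
    have lc: "Polynomial.coeff (m * sl_poly a n) (Polynomial.degree f) = lead_coeff f"
      using False lead_coeff_mult[of m "sl_poly a n"] f0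
      by (simp add: dm) (simp add: m_def degree_monom_eq coeff_sl_poly)
    have "Polynomial.degree h < Polynomial.degree f"
    proof -
      have "Polynomial.degree h \<le> Polynomial.degree f"
        unfolding h_def by (rule degree_diff_le) (auto simp: dm)
      moreover have "Polynomial.degree h \<noteq> Polynomial.degree f"
      proof
        assume *: "Polynomial.degree h = Polynomial.degree f"
        hence "lead_coeff h = 0" by (simp add: h_def lc)
        hence "h = 0" by (simp only: Polynomial.leading_coeff_0_iff)
        thus False using f0 * by simp
      qed
      ultimately show ?thesis by simp
    qed
    from less.hyps[OF this h] obtain q r where qr: "q \<in> carrier (sl_poly_ring a n)"
      "r \<in> carrier (sl_poly_ring a n)" "h = q * sl_poly a n + r" "Polynomial.degree r < n"
      by auto
    have "f = (m + q) * sl_poly a n + r"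
      using qr(3) unfolding h_def by (simp add: algebra_simps)
    thus ?thesis
      using qr(2,4) sl_poly_ring_closed(1)[OF m qr(1)]
      by (intro bexI[of _ "m + q"] bexI[of _ r] conjI)
  qed
qed

lemma sl_poly_mod:
  assumes "n \<ge> 1" "f \<in> carrier (sl_poly_ring a n)"
  shows "f div sl_poly a n \<in> carrier (sl_poly_ring a n)"
    and "f mod sl_poly a n \<in> carrier (sl_poly_ring a n)"
proof -
  obtain q r where qr: "q \<in> carrier (sl_poly_ring a n)"
    "r \<in> carrier (sl_poly_ring a n)" "f = q * sl_poly a n + r" "Polynomial.degree r < n"
    using sl_poly_division[OF assms] by auto
  have r: "r div sl_poly a n = 0" "r mod sl_poly a n = r"
    using qr(4) by (auto intro!: div_poly_less mod_poly_less)
  show "f div sl_poly a n \<in> carrier (sl_poly_ring a n)"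
    "f mod sl_poly a n \<in> carrier (sl_poly_ring a n)"
    using qr(1,2) r unfolding qr(3) by simp_all
qed

lemma degree_mod_sl: "n \<ge> 1 \<Longrightarrow> Polynomial.degree (f mod sl_poly a n) < n"
  using degree_mod_less[of "sl_poly a n" f] by auto

lemma sl_class_mod:
  assumes "n \<ge> 1" "f \<in> carrier (sl_poly_ring a n)"
  shows "sl_class a n (f mod sl_poly a n) = sl_class a n f"
  using sl_class_eqI[OF assms(2) sl_poly_mod(2)[OF assms] sl_poly_mod(1)[OF assms]
    div_mult_mod_eq[symmetric]] ..

lemma sl_form_class:
  assumes "n \<ge> 1" "f \<in> carrier (sl_poly_ring a n)"
  shows "sl_form a n (sl_class a n f) = Polynomial.coeff (f mod sl_poly a n) (n - 1)"
  unfolding sl_form_def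
proof (rule the_equality)
  have "f mod sl_poly a n \<in> sl_class a n f"
    unfolding sl_class_mem
    by (rule bexI[of _ "- (f div sl_poly a n)"])
      (auto simp: sl_poly_mod[OF assms] sl_poly_ring_closed minus_div_mult_eq_mod[symmetric])
  thus "\<exists>h\<in>sl_class a n f. Polynomial.degree h < n \<and>
      Polynomial.coeff (f mod sl_poly a n) (n - 1) = Polynomial.coeff h (n - 1)"
    using degree_mod_sl[OF assms(1)] by blast
next
  fix c assume "\<exists>h\<in>sl_class a n f. Polynomial.degree h < n \<and> c = Polynomial.coeff h (n - 1)"
  then obtain h q where h: "Polynomial.degree h < n" "c = Polynomial.coeff h (n - 1)"
    "h = q * sl_poly a n + f" by (auto simp: sl_class_mem)
  have "h mod sl_poly a n = h" using h(1) by (intro mod_poly_less) auto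
  hence "h = f mod sl_poly a n" unfolding h(3) by simp
  thus "c = Polynomial.coeff (f mod sl_poly a n) (n - 1)" using h(2) by simp
qed

lemma sl_class_carrier:
  "f \<in> carrier (sl_poly_ring a n) \<Longrightarrow> sl_class a n f \<in> carrier (sl_ext a n)"
  using ring_hom_cring.homh[OF sl_class_hom] by (rule ring_hom_closed)

lemma sl_class_mult:
  "f \<in> carrier (sl_poly_ring a n) \<Longrightarrow> h \<in> carrier (sl_poly_ring a n) \<Longrightarrow>
     sl_class a n f \<otimes>\<^bsub>sl_ext a n\<^esub> sl_class a n h = sl_class a n (f * h)"
  using ring_hom_mult[OF ring_hom_cring.homh[OF sl_class_hom]] by simp

lemma sl_class_add:
  "f \<in> carrier (sl_poly_ring a n) \<Longrightarrow> h \<in> carrier (sl_poly_ring a n) \<Longrightarrow>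
     sl_class a n f \<oplus>\<^bsub>sl_ext a n\<^esub> sl_class a n h = sl_class a n (f + h)"
  using ring_hom_add[OF ring_hom_cring.homh[OF sl_class_hom]] by simp

lemma sl_class_sum:
  assumes "finite I" "\<And>i. i \<in> I \<Longrightarrow> f i \<in> carrier (sl_poly_ring a n)"
  shows "(\<Oplus>\<^bsub>sl_ext a n\<^esub>i\<in>I. sl_class a n (f i)) = sl_class a n (\<Sum>i\<in>I. f i)"
  using assms
proof (induction I rule: finite_induct)
  interpret A: cring "sl_ext a n" by (rule cring_sl_ext)
  interpret h: ring_hom_cring "sl_poly_ring a n" "sl_ext a n" "sl_class a n"
    by (rule sl_class_hom)
  case empty
  show ?case using h.hom_zero by simp
next
  interpret A: cring "sl_ext a n" by (rule cring_sl_ext)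
  case (insert i I)
  have "(\<Oplus>\<^bsub>sl_ext a n\<^esub>j\<in>insert i I. sl_class a n (f j)) =
      sl_class a n (f i) \<oplus>\<^bsub>sl_ext a n\<^esub> (\<Oplus>\<^bsub>sl_ext a n\<^esub>j\<in>I. sl_class a n (f j))"
    using insert by (intro A.finsum_insert) (auto intro: sl_class_carrier)
  also have "\<dots> = sl_class a n (f i + (\<Sum>j\<in>I. f j))"
    using insert by (simp add: sl_class_add sl_poly_ring_sum)
  finally show ?case using insert by simp
qed

lemma sl_form_Pi:
  assumes "n \<ge> 1"
  shows "sl_form a n \<in> carrier (sl_ext a n) \<rightarrow> sl_base a n"
proof
  fix u assume "u \<in> carrier (sl_ext a n)"
  then obtain f where "f \<in> carrier (sl_poly_ring a n)" "u = sl_class a n f"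
    by (rule sl_ext_carrierE)
  thus "sl_form a n u \<in> sl_base a n"
    using sl_poly_mod(2)[OF assms] assms by (simp add: sl_form_class sl_poly_ring_carrier)
qed

lemma sl_form_add:
  assumes "n \<ge> 1" "u \<in> carrier (sl_ext a n)" "v \<in> carrier (sl_ext a n)"
  shows "sl_form a n (u \<oplus>\<^bsub>sl_ext a n\<^esub> v) = sl_form a n u + sl_form a n v"
  using assms(2,3)
  by (elim sl_ext_carrierE)
    (simp add: sl_class_add sl_form_class[OF assms(1)] sl_poly_ring_closed poly_mod_add_left)

lemma sl_form_scale:
  assumes "n \<ge> 1" "c \<in> sl_base a n" "u \<in> carrier (sl_ext a n)"
  shows "sl_form a n (sl_embed a n c \<otimes>\<^bsub>sl_ext a n\<^esub> u) = c * sl_form a n u"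
  using assms(2,3) unfolding sl_embed_def
  by (elim sl_ext_carrierE)
    (simp add: sl_class_mult sl_form_class[OF assms(1)] sl_poly_ring_closed mod_smult_left)

lemma sl_form_basis:
  assumes "k < n"
  shows "sl_form a n (sl_class a n (Polynomial.monom 1 k)) = (if k = n - 1 then 1 else 0)"
  using assms
  by (subst sl_form_class)
    (auto simp: sl_poly_ring_closed sl_base_one mod_poly_less degree_monom_eq)

lemma sl_poly_Suc: "sl_poly a (Suc k) = [:0, 1:] * sl_poly a k - [:a (Suc k):]"
  by (rule poly_eqI) (auto simp: coeff_sl_poly coeff_pCons Suc_diff_Suc split: nat.splits)

lemma coeff_sl_poly_mult_mod:
  assumes "k < n"
  shows "Polynomial.coeff (sl_poly a k * f mod sl_poly a n) (n - 1) =
         Polynomial.coeff (f mod sl_poly a n) (n - 1 - k)"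
  using assms
proof (induction k arbitrary: f)
  case 0
  have "sl_poly a 0 = 1" by (simp add: sl_poly_def)
  thus ?case by simp
next
  case (Suc k)
  define p where "p = sl_poly a n"
  define r where "r = f mod p"
  define c where "c = Polynomial.coeff r (n - 1)"
  have n: "n \<ge> 1" using Suc by simp
  have dr: "Polynomial.degree r < n" using degree_mod_sl[OF n] by (simp add: r_def p_def)
  have x: "[:0, 1:] * f mod p = [:0, 1:] * r - Polynomial.smult c p"
  proof -
    have co: "Polynomial.coeff ([:0, 1:] * r - Polynomial.smult c p) i = 0" if "i \<ge> n" for i
      using that dr n
      by (auto simp: c_def p_def coeff_sl_poly coeff_pCons split: nat.splits
          intro!: coeff_eq_0)
    have "Polynomial.degree ([:0, 1:] * r - Polynomial.smult c p) \<le> n - 1"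
      by (rule degree_le) (use co n in auto)
    hence "([:0, 1:] * r - Polynomial.smult c p) mod p = [:0, 1:] * r - Polynomial.smult c p"
      using n by (intro mod_poly_less) (auto simp: p_def)
    moreover have "([:0, 1:] * r - Polynomial.smult c p) mod p = [:0, 1:] * r mod p"
      by (simp add: poly_mod_diff_left mod_smult_left)
    moreover have "[:0, 1:] * r mod p = [:0, 1:] * f mod p"
      unfolding r_def by (rule mod_mult_right_eq)
    ultimately show ?thesis by simp
  qed
  have "sl_poly a (Suc k) * f = sl_poly a k * ([:0, 1:] * f) - Polynomial.smult (a (Suc k)) f"
    by (simp add: sl_poly_Suc algebra_simps)
  hence "Polynomial.coeff (sl_poly a (Suc k) * f mod p) (n - 1) =
      Polynomial.coeff (sl_poly a k * ([:0, 1:] * f) mod p) (n - 1) - a (Suc k) * c"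
    by (simp only: poly_mod_diff_left mod_smult_left coeff_diff coeff_smult r_def c_def)
  also have "Polynomial.coeff (sl_poly a k * ([:0, 1:] * f) mod p) (n - 1) =
      Polynomial.coeff ([:0, 1:] * f mod p) (n - 1 - k)"
    using Suc.IH[of "[:0, 1:] * f"] Suc.prems unfolding p_def by (simp del: mult_pCons_left)
  also have "\<dots> = Polynomial.coeff r (n - 1 - Suc k) + a (Suc k) * c"
  proof -
    obtain m where m: "n = Suc (Suc (k + m))"
      using Suc.prems less_imp_Suc_add by (metis add_Suc)
    show ?thesis unfolding x by (simp add: p_def coeff_sl_poly m)
  qed
  finally show ?case by (simp add: p_def r_def)
qed

lemma sl_dual_expansion1:
  assumes "n \<ge> 1"
  shows "(\<Sum>k=0..n - 1. Polynomial.monom 1 (n - 1 - k) *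
           [:Polynomial.coeff (sl_poly a k * f mod sl_poly a n) (n - 1):]) = f mod sl_poly a n"
proof -
  have "(\<Sum>k=0..n - 1. Polynomial.monom 1 (n - 1 - k) *
           [:Polynomial.coeff (sl_poly a k * f mod sl_poly a n) (n - 1):]) =
        (\<Sum>k=0..n - 1. Polynomial.monom (Polynomial.coeff (f mod sl_poly a n) (n - 1 - k)) (n - 1 - k))"
  proof (intro sum.cong refl)
    fix k assume "k \<in> {0..n - 1}"
    hence "k < n" using assms by auto
    from coeff_sl_poly_mult_mod[OF this]
    show "Polynomial.monom 1 (n - 1 - k) *
        [:Polynomial.coeff (sl_poly a k * f mod sl_poly a n) (n - 1):] =
      Polynomial.monom (Polynomial.coeff (f mod sl_poly a n) (n - 1 - k)) (n - 1 - k)"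
      by (simp only:) (simp add: smult_monom)
  qed
  also have "\<dots> = (\<Sum>k=0..n - 1. Polynomial.monom (Polynomial.coeff (f mod sl_poly a n) k) k)"
    by (subst sum.atLeastAtMost_rev) simp
  also have "\<dots> = f mod sl_poly a n"
    using poly_as_sum_of_monoms'[of "f mod sl_poly a n" "n - 1"] degree_mod_sl[OF assms, of f a]
    by (simp add: atLeast0AtMost)
  finally show ?thesis .
qed

lemma sl_dual_expansion2:
  assumes "n \<ge> 1"
  shows "(\<Sum>k=0..n - 1. [:Polynomial.coeff (f * Polynomial.monom 1 (n - 1 - k) mod sl_poly a n) (n - 1):] *
           sl_poly a k) = f mod sl_poly a n"
proof -
  define p where "p = sl_poly a n"
  define E where "E f = Polynomial.coeff (f mod p) (n - 1)" for f
  have E_diff: "E (f - h) = E f - E h" for f h by (simp add: E_def poly_mod_diff_left)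
  have E_smult: "E (Polynomial.smult c f) = c * E f" for c f by (simp add: E_def mod_smult_left)
  have E_0: "E 0 = 0" by (simp add: E_def)
  have E_add: "E (f + h) = E f + E h" for f h by (simp add: E_def poly_mod_add_left)
  have E_sum: "E (\<Sum>i\<in>I. f i) = (\<Sum>i\<in>I. E (f i))" if "finite I" for I :: "nat set" and f
    using that by (induction I rule: finite_induct) (auto simp: E_0 E_add)
  define s where "s = (\<Sum>k=0..n - 1. Polynomial.smult (E (f * Polynomial.monom 1 (n - 1 - k))) (sl_poly a k))"
  have Es: "E (s * Polynomial.monom 1 (n - 1 - i)) = E (f * Polynomial.monom 1 (n - 1 - i))"
    if i: "i < n" for i
  proof -
    have "E (s * Polynomial.monom 1 (n - 1 - i)) =
      (\<Sum>k=0..n - 1. E (f * Polynomial.monom 1 (n - 1 - k)) *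
         E (sl_poly a k * Polynomial.monom 1 (n - 1 - i)))"
      by (simp add: s_def sum_distrib_right E_sum E_smult)
    also have "\<dots> = (\<Sum>k=0..n - 1. if k = i then E (f * Polynomial.monom 1 (n - 1 - k)) else 0)"
    proof (intro sum.cong refl)
      fix k assume "k \<in> {0..n - 1}"
      hence k: "k < n" using i by auto
      have "Polynomial.monom 1 (n - 1 - i) mod p = Polynomial.monom 1 (n - 1 - i)"
        using i by (intro mod_poly_less) (auto simp: p_def degree_monom_eq)
      hence "E (sl_poly a k * Polynomial.monom 1 (n - 1 - i)) = (if k = i then 1 else 0)"
        using k i coeff_sl_poly_mult_mod[OF k, of a "Polynomial.monom 1 (n - 1 - i)"]
        by (auto simp: E_def p_def)
      thus "E (f * Polynomial.monom 1 (n - 1 - k)) * E (sl_poly a k * Polynomial.monom 1 (n - 1 - i)) =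
        (if k = i then E (f * Polynomial.monom 1 (n - 1 - k)) else 0)" by simp
    qed
    finally show ?thesis using i by auto
  qed
  define h where "h = s - f"
  have Eh: "E (h * Polynomial.monom 1 j) = 0" if "j < n" for j
    using Es[of "n - 1 - j"] that by (simp add: h_def left_diff_distrib E_diff)
  have "Polynomial.coeff (h mod p) j = 0" for j
  proof (cases "j < n")
    case True
    define k where "k = n - 1 - j"
    have k: "k < n" "n - 1 - k = j" using True by (auto simp: k_def)
    have "Polynomial.coeff (h mod p) j = E (sl_poly a k * h)"
      using coeff_sl_poly_mult_mod[OF k(1), of a h] k by (simp add: E_def p_def)
    also have "sl_poly a k = (\<Sum>i\<le>k. Polynomial.monom (Polynomial.coeff (sl_poly a k) i) i)"
      using poly_as_sum_of_monoms[of "sl_poly a k"] by simp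
    also have "\<dots> * h = (\<Sum>i\<le>k. Polynomial.smult (Polynomial.coeff (sl_poly a k) i) (h * Polynomial.monom 1 i))"
      unfolding sum_distrib_right
      by (intro sum.cong refl) (simp add: mult.commute smult_monom flip: mult_smult_right)
    also have "E \<dots> = 0"
      using k by (simp add: E_sum E_smult Eh)
    finally show ?thesis .
  next
    case False
    thus ?thesis using degree_mod_sl[OF assms, of h a] by (intro coeff_eq_0) (simp add: p_def)
  qed
  hence "h mod p = 0" by (intro poly_eqI) simp
  hence "s mod p = f mod p" by (simp add: h_def poly_mod_diff_left)
  moreover have "s mod p = s"
  proof -
    have "Polynomial.degree s \<le> n - 1" unfolding s_def
      by (intro degree_sum_le) (auto intro: order.trans[OF degree_smult_le])
    thus ?thesis using assms by (intro mod_poly_less) (auto simp: p_def)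
  qed
  ultimately show ?thesis by (simp add: s_def E_def p_def)
qed

lemma sl_dual_basis:
  assumes "n \<ge> 1" "u \<in> carrier (sl_ext a n)"
  shows "u = (\<Oplus>\<^bsub>sl_ext a n\<^esub>k\<in>{0..n - 1}. sl_dual_x a n k \<otimes>\<^bsub>sl_ext a n\<^esub>
               sl_embed a n (sl_form a n (sl_dual_y a n k \<otimes>\<^bsub>sl_ext a n\<^esub> u)))"
    and "u = (\<Oplus>\<^bsub>sl_ext a n\<^esub>k\<in>{0..n - 1}.
               sl_embed a n (sl_form a n (u \<otimes>\<^bsub>sl_ext a n\<^esub> sl_dual_x a n k))
               \<otimes>\<^bsub>sl_ext a n\<^esub> sl_dual_y a n k)"
proof -
  interpret A: cring "sl_ext a n" by (rule cring_sl_ext)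
  obtain f where f: "f \<in> carrier (sl_poly_ring a n)" "u = sl_class a n f"
    using assms(2) by (rule sl_ext_carrierE)
  have y: "sl_poly a k \<in> carrier (sl_poly_ring a n)" if "k \<in> {0..n - 1}" for k
    using that by (intro sl_poly_closed) auto
  have x: "Polynomial.monom 1 k \<in> carrier (sl_poly_ring a n)" for k
    by (intro sl_poly_ring_closed sl_base_one)
  have c: "[:Polynomial.coeff (h mod sl_poly a n) i:] \<in> carrier (sl_poly_ring a n)"
    if "h \<in> carrier (sl_poly_ring a n)" for h i
    using sl_poly_mod(2)[OF assms(1) that]
    by (intro sl_poly_ring_closed) (auto simp: sl_poly_ring_carrier)
  have "(\<Oplus>\<^bsub>sl_ext a n\<^esub>k\<in>{0..n - 1}. sl_dual_x a n k \<otimes>\<^bsub>sl_ext a n\<^esub>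
               sl_embed a n (sl_form a n (sl_dual_y a n k \<otimes>\<^bsub>sl_ext a n\<^esub> u))) =
      (\<Oplus>\<^bsub>sl_ext a n\<^esub>k\<in>{0..n - 1}. sl_class a n (Polynomial.monom 1 (n - 1 - k) *
           [:Polynomial.coeff (sl_poly a k * f mod sl_poly a n) (n - 1):]))"
    by (rule A.finsum_cong')
      (simp_all only: Pi_I sl_dual_x_def sl_dual_y_def sl_embed_def f sl_class_mult x y c
        sl_class_carrier sl_form_class[OF assms(1)] sl_poly_ring_closed(2))
  also have "\<dots> = sl_class a n (\<Sum>k=0..n - 1. Polynomial.monom 1 (n - 1 - k) *
           [:Polynomial.coeff (sl_poly a k * f mod sl_poly a n) (n - 1):])"
    by (rule sl_class_sum) (auto simp del: mult_pCons_right intro!: sl_poly_ring_closed(2) x y c f)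
  also have "(\<Sum>k=0..n - 1. Polynomial.monom 1 (n - 1 - k) *
           [:Polynomial.coeff (sl_poly a k * f mod sl_poly a n) (n - 1):]) = f mod sl_poly a n"
    by (rule sl_dual_expansion1[OF assms(1)])
  also have "sl_class a n (f mod sl_poly a n) = u" using assms f by (simp add: sl_class_mod)
  finally show "u = (\<Oplus>\<^bsub>sl_ext a n\<^esub>k\<in>{0..n - 1}. sl_dual_x a n k \<otimes>\<^bsub>sl_ext a n\<^esub>
      sl_embed a n (sl_form a n (sl_dual_y a n k \<otimes>\<^bsub>sl_ext a n\<^esub> u)))" ..
  have "(\<Oplus>\<^bsub>sl_ext a n\<^esub>k\<in>{0..n - 1}.
               sl_embed a n (sl_form a n (u \<otimes>\<^bsub>sl_ext a n\<^esub> sl_dual_x a n k))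
               \<otimes>\<^bsub>sl_ext a n\<^esub> sl_dual_y a n k) =
      (\<Oplus>\<^bsub>sl_ext a n\<^esub>k\<in>{0..n - 1}. sl_class a n
         ([:Polynomial.coeff (f * Polynomial.monom 1 (n - 1 - k) mod sl_poly a n) (n - 1):] * sl_poly a k))"
    by (rule A.finsum_cong')
      (simp_all only: Pi_I sl_dual_x_def sl_dual_y_def sl_embed_def f sl_class_mult x y c
        sl_class_carrier sl_form_class[OF assms(1)] sl_poly_ring_closed(2))
  also have "\<dots> = sl_class a n (\<Sum>k=0..n - 1.
      [:Polynomial.coeff (f * Polynomial.monom 1 (n - 1 - k) mod sl_poly a n) (n - 1):] * sl_poly a k)"
    by (rule sl_class_sum) (auto simp del: mult_pCons_left intro!: sl_poly_ring_closed(2) x y c f)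
  also have "(\<Sum>k=0..n - 1.
      [:Polynomial.coeff (f * Polynomial.monom 1 (n - 1 - k) mod sl_poly a n) (n - 1):] * sl_poly a k) = f mod sl_poly a n"
    by (rule sl_dual_expansion2[OF assms(1)])
  also have "sl_class a n (f mod sl_poly a n) = u" using assms f by (simp add: sl_class_mod)
  finally show "u = (\<Oplus>\<^bsub>sl_ext a n\<^esub>k\<in>{0..n - 1}.
               sl_embed a n (sl_form a n (u \<otimes>\<^bsub>sl_ext a n\<^esub> sl_dual_x a n k))
               \<otimes>\<^bsub>sl_ext a n\<^esub> sl_dual_y a n k)" ..
qed

lemma of_nat_mult_monom:
  "of_nat m * Polynomial.monom c k = Polynomial.monom (of_nat m * c) k"
  by (simp add: of_nat_poly smult_monom)

lemma sl_genus_explicit: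
  assumes "n \<ge> 1"
  shows "sl_genus a n = sl_class a n (Polynomial.monom (of_nat n) (n - 1) -
           (\<Sum>i=1..n - 1. Polynomial.monom (of_nat (n - i) * a i) (n - 1 - i)))"
proof -
  interpret A: cring "sl_ext a n" by (rule cring_sl_ext)
  have y: "sl_poly a k \<in> carrier (sl_poly_ring a n)" if "k \<in> {0..n - 1}" for k
    using that by (intro sl_poly_closed) auto
  have x: "Polynomial.monom 1 k \<in> carrier (sl_poly_ring a n)" for k
    by (intro sl_poly_ring_closed sl_base_one)
  have "sl_genus a n = (\<Oplus>\<^bsub>sl_ext a n\<^esub>k\<in>{0..n - 1}.
      sl_class a n (Polynomial.monom 1 (n - 1 - k) * sl_poly a k))"
    unfolding sl_genus_def
    by (rule A.finsum_cong')
      (simp_all only: Pi_I sl_dual_x_def sl_dual_y_def sl_class_mult x y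
        sl_class_carrier sl_poly_ring_closed(2))
  also have "\<dots> = sl_class a n (\<Sum>k=0..n - 1. Polynomial.monom 1 (n - 1 - k) * sl_poly a k)"
    by (rule sl_class_sum) (auto intro!: sl_poly_ring_closed(2) x y)
  also have "(\<Sum>k=0..n - 1. Polynomial.monom 1 (n - 1 - k) * sl_poly a k) =
      (\<Sum>k=0..n - 1. Polynomial.monom 1 (n - 1) - (\<Sum>i=1..k. Polynomial.monom (a i) (n - 1 - i)))"
    using assms
    by (intro sum.cong refl)
      (auto simp: sl_poly_def right_diff_distrib sum_distrib_left mult_monom
        intro!: sum.cong arg_cong2[of _ _ _ _ "(-)"] arg_cong2[of _ _ _ _ Polynomial.monom])
  also have "\<dots> = Polynomial.monom (of_nat n) (n - 1) -
      (\<Sum>k=0..n - 1. \<Sum>i=1..k. Polynomial.monom (a i) (n - 1 - i))"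
    using assms by (simp add: sum_subtractf of_nat_mult_monom del: of_nat_Suc)
  also have "(\<Sum>k=0..n - 1. \<Sum>i=1..k. Polynomial.monom (a i) (n - 1 - i)) =
      (\<Sum>k=0..n - 1. \<Sum>i=1..n - 1. if i \<le> k then Polynomial.monom (a i) (n - 1 - i) else 0)"
    by (intro sum.cong refl sum.mono_neutral_cong_left) auto
  also have "\<dots> = (\<Sum>i=1..n - 1. \<Sum>k=0..n - 1. if i \<le> k then Polynomial.monom (a i) (n - 1 - i) else 0)"
    by (rule sum.swap)
  also have "\<dots> = (\<Sum>i=1..n - 1. Polynomial.monom (of_nat (n - i) * a i) (n - 1 - i))"
  proof (intro sum.cong refl)
    fix i assume i: "i \<in> {1..n - 1}"
    have "(\<Sum>k=0..n - 1. if i \<le> k then Polynomial.monom (a i) (n - 1 - i) else 0) =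
        (\<Sum>k=i..n - 1. Polynomial.monom (a i) (n - 1 - i))"
      by (intro sum.mono_neutral_cong_right) auto
    also have "\<dots> = Polynomial.monom (of_nat (n - i) * a i) (n - 1 - i)"
      using i by (simp add: of_nat_mult_monom Suc_diff_le del: of_nat_Suc) linarith
    finally show "(\<Sum>k=0..n - 1. if i \<le> k then Polynomial.monom (a i) (n - 1 - i) else 0) =
      Polynomial.monom (of_nat (n - i) * a i) (n - 1 - i)" .
  qed
  finally show ?thesis .
qed

end

theory Submission
  imports Defs
begin

text \<open>The explicit formula for the genus-reduction term says that \<open>g\<close> is the class of the
  derivative \<open>p'\<close>. If \<open>g\<^sup>2 = 0\<close>, then \<open>p\<close> divides \<open>p'\<^sup>2\<close>, so every root of \<open>p\<close> is a root of
  \<open>p'\<close> and hence a multiple root of \<open>p\<close>.\<close>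

lemma pderiv_sl_poly:
  assumes "n \<ge> 1"
  shows "pderiv (sl_poly a n) = Polynomial.monom (of_nat n) (n - 1) -
           (\<Sum>i=1..n - 1. Polynomial.monom (of_nat (n - i) * a i) (n - 1 - i))"
proof -
  \<comment> \<open>The term \<open>i = n\<close> has coefficient \<open>n - i = 0\<close>, so the
    truncated exponent there does no harm.\<close>
  have "(\<Sum>i=1..n. Polynomial.monom (of_nat (n - i) * a i) (n - i - 1)) =
      (\<Sum>i=1..n - 1. Polynomial.monom (of_nat (n - i) * a i) (n - 1 - i))"
    using assms by (intro sum.mono_neutral_cong_right) auto
  thus ?thesis
    by (simp add: sl_poly_def pderiv_diff higher_pderiv_sum[of 1, simplified] pderiv_monom)
qed

lemma sl_genus_eq_class_pderiv:
  "n \<ge> 1 \<Longrightarrow> sl_genus a n = sl_class a n (pderiv (sl_poly a n))"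
  by (simp only: sl_genus_explicit pderiv_sl_poly)

text \<open>The base ring contains all natural numbers; closure is what makes the class map
  multiplicative at \<open>p'\<close>.\<close>

lemma pderiv_closed:
  assumes "f \<in> carrier (sl_poly_ring a n)"
  shows "pderiv f \<in> carrier (sl_poly_ring a n)"
proof -
  have "of_nat k \<in> sl_base a n" for k
    by (induction k) (auto simp: sl_base_zero sl_base_one sl_base_add)
  from sl_base_mult[OF this] show ?thesis
    using assms by (auto simp: sl_poly_ring_carrier coeff_pderiv simp del: of_nat_Suc)
qed

text \<open>A coset contains its representative, and the zero coset consists of multiples of
  \<open>p\<close>. Divisibility over the complex numbers suffices for evaluation at a complex
  root.\<close>

lemma sl_class_eq_zero_imp_dvd:
  assumes "sl_class a n f = \<zero>\<^bsub>sl_ext a n\<^esub>"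
  shows "sl_poly a n dvd f"
proof -
  have "sl_class a n f = sl_class a n 0"
    using ring_hom_cring.hom_zero[OF sl_class_hom, of a n] assms by simp
  moreover have "f \<in> sl_class a n f"
    by (auto simp: sl_class_mem sl_poly_ring_carrier sl_base_zero intro!: bexI[of _ 0])
  ultimately show ?thesis by (auto simp: sl_class_mem)
qed

text \<open>In characteristic 0, differentiation lowers the order of a root by exactly one, here to
  0.\<close>

lemma poly_pderiv_nonzero_if_order_1:
  fixes p :: "'a::{idom,semiring_char_0} poly"
  assumes "p \<noteq> 0" "Polynomial.order z p = 1"
  shows "poly (pderiv p) z \<noteq> 0"
proof -
  have root: "poly p z = 0" using assms by (simp add: order_root)
  \<comment> \<open>Order 0 rules out a root only for a nonzero polynomial; \<open>p\<close> is not
    constant, as it is nonzero and has a root.\<close>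
  have "pderiv p \<noteq> 0"
  proof
    assume "pderiv p = 0"
    then obtain c where "p = [:c:]" using pderiv_iszero by blast
    thus False using root assms(1) by simp
  qed
  thus ?thesis using order_pderiv[OF assms(1) root] assms(2) by (simp add: order_root)
qed

theorem theorem4p6:
  fixes n :: nat and a :: "nat \<Rightarrow> complex"
  assumes "n \<ge> 2"
    and "\<exists>z. Polynomial.order z (sl_poly a n) = 1"
  shows "sl_genus a n [^]\<^bsub>sl_ext a n\<^esub> (2::nat) \<noteq> \<zero>\<^bsub>sl_ext a n\<^esub>"
proof
  interpret A: cring "sl_ext a n" by (rule cring_sl_ext)
  let ?p = "sl_poly a n"
  assume g2: "sl_genus a n [^]\<^bsub>sl_ext a n\<^esub> (2::nat) = \<zero>\<^bsub>sl_ext a n\<^esub>"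
  obtain z where z: "Polynomial.order z ?p = 1" using assms(2) by blast
  have closed: "pderiv ?p \<in> carrier (sl_poly_ring a n)"
    by (intro pderiv_closed sl_poly_closed order.refl)
  have "sl_class a n (pderiv ?p * pderiv ?p) = \<zero>\<^bsub>sl_ext a n\<^esub>"
    using g2 assms(1) sl_class_carrier[OF closed]
    by (simp add: sl_genus_eq_class_pderiv numeral_2_eq_2 sl_class_mult[OF closed closed])
  hence "?p dvd pderiv ?p * pderiv ?p" by (rule sl_class_eq_zero_imp_dvd)
  moreover have "poly ?p z = 0" using z by (auto simp: order_root)
  ultimately have "poly (pderiv ?p) z = 0" by (metis dvd_trans mult_eq_0_iff poly_eq_0_iff_dvd poly_mult)
  thus False using poly_pderiv_nonzero_if_order_1[OF sl_poly_nz z] by contradiction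
qed

end
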